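(* Let $q\ge0$, $h>0$ and $\gamma,\beta\ge0$, and let $$T_q=\begin{pmatrix}1-\dfrac{h^2q}{1+h\gamma}&\dfrac{h(1-hq\beta)}{1+h\gamma}\\[1em]-\dfrac{hq}{1+h\gamma}&\dfrac{1-hq\beta}{1+h\gamma}\end{pmatrix}.$$ (i) If $q>0$ and $\gamma+q\beta>0$, then $T_q$ is Schur stable if and only if $$qh(h+2\beta)<4+2h\gamma .$$ When $qh(h+2\beta)=4+2h\gamma$, $-1$ is an eigenvalue of $T_q$ and the other eigenvalue lies strictly inside the unit disk. If $qh(h+2\beta)>4+2h\gamma$, $T_q$ has a real eigenvalue strictly smaller than $-1$. (ii) If $q=0$, the eigenvalues of $T_q$ are $1$ and $(1+h\gamma)^{-1}$; hence $T_q$ is never Schur stable. For $\gamma>0$ it is semistable; for $\gamma=0$, the matrix is a nontrivial Jordan block at $1$ (i.e. $1$ is a double, defective eigenvalue). (iii) If $q>0$ and $\gamma=\beta=0$, then $T_q$ is not Schur stable for any $h>0$. It is marginally stable for $0<h<2/\sqrt q$. At $h=2/\sqrt q$ it has a defective double eigenvalue $-1$, and for $h>2/\sqrt q$ its spectral radius is larger than one.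
   Context: A real square matrix is Schur stable if its spectral radius is strictly less than $1$. It is semistable (respectively marginally stable) if its spectral radius equals $1$ and every eigenvalue of modulus one is semisimple; here in the semistable case of (ii) the only eigenvalue of modulus one is $1$, and in the marginally stable case of (iii) the eigenvalues are of modulus one. A double eigenvalue is defective if its eigenspace is one-dimensional. *)

theory Defs
  imports
    Complex_Main
    "Jordan_Normal_Form.Spectral_Radius"
    "Jordan_Normal_Form.Matrix_Kernel"
begin

(* Eigenvalues of a real matrix are always taken over the complex numbers. *)
abbreviation cmat :: "real mat \<Rightarrow> complex mat" where
  "cmat A \<equiv> map_mat complex_of_real A"

definition schur_stable :: "real mat \<Rightarrow> bool" where
  "schur_stable A \<longleftrightarrow> square_mat A \<and> spectral_radius (cmat A) < 1"

definition alg_mult :: "complex mat \<Rightarrow> complex \<Rightarrow> nat" where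
  "alg_mult A z = Polynomial.order z (char_poly A)"

(* char_matrix A z is A - z I, so its kernel is the eigenspace of A at z. *)
definition geom_mult :: "complex mat \<Rightarrow> complex \<Rightarrow> nat" where
  "geom_mult A z = kernel_dim (char_matrix A z)"

definition semisimple_eigenvalue :: "complex mat \<Rightarrow> complex \<Rightarrow> bool" where
  "semisimple_eigenvalue A z \<longleftrightarrow> eigenvalue A z \<and> geom_mult A z = alg_mult A z"

definition semistable :: "real mat \<Rightarrow> bool" where
  "semistable A \<longleftrightarrow> square_mat A \<and> spectral_radius (cmat A) = 1 \<and>
     (\<forall>z. eigenvalue (cmat A) z \<and> cmod z = 1 \<longrightarrow> semisimple_eigenvalue (cmat A) z)"

(* The two words name the same property.  They differ in usage only in where the eigenvalues
   of modulus one lie, which is asserted separately wherever it matters. *)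
abbreviation marginally_stable :: "real mat \<Rightarrow> bool" where
  "marginally_stable A \<equiv> semistable A"

definition defective_double_eigenvalue :: "real mat \<Rightarrow> complex \<Rightarrow> bool" where
  "defective_double_eigenvalue A z \<longleftrightarrow>
     eigenvalue (cmat A) z \<and> alg_mult (cmat A) z = 2 \<and> geom_mult (cmat A) z = 1"

definition T_mat :: "real \<Rightarrow> real \<Rightarrow> real \<Rightarrow> real \<Rightarrow> real mat" where
  "T_mat h \<gamma> \<beta> q = mat_of_rows_list 2
     [[1 - h^2 * q / (1 + h * \<gamma>), h * (1 - h * q * \<beta>) / (1 + h * \<gamma>)],
      [- (h * q / (1 + h * \<gamma>)),  (1 - h * q * \<beta>) / (1 + h * \<gamma>)]]"

end

theory Submission
  imports Defs
begin

text \<open>The characteristic polynomial is \<open>z\<^sup>2 - t z + D\<close> with \<open>D = (1 - h q \<beta>) / (1 + h \<gamma>)\<close>; its values at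
  \<open>1\<close> and \<open>-1\<close> are \<open>h\<^sup>2 q / (1 + h \<gamma>)\<close> and \<open>(4 + 2 h \<gamma> - q h (h + 2 \<beta>)) / (1 + h \<gamma>)\<close>. When
  \<open>q > 0\<close> and \<open>\<gamma> + q \<beta> > 0\<close> we have \<open>D < 1\<close> and positivity at \<open>1\<close>, so by the Jury criterion only the
  sign at \<open>-1\<close> matters. In the remaining cases the upper right entry of the matrix is nonzero, so all
  eigenspaces are lines and semisimplicity amounts to simplicity of the root.\<close>

section \<open>Determinant, characteristic polynomial and eigenspaces of two-by-two matrices\<close>

lemma det_2:
  assumes A: "(A :: 'a :: comm_ring_1 mat) \<in> carrier_mat 2 2"
  shows "det A = A $$ (0,0) * A $$ (1,1) - A $$ (0,1) * A $$ (1,0)"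
proof -
  have "det A = (\<Sum>i<2. A $$ (i,0) * cofactor A i 0)"
    by (rule laplace_expansion_column[OF A]) simp
  then show ?thesis
    using A by (auto simp: numeral_2_eq_2 cofactor_def mat_delete_def det_single mult.commute)
qed

lemma char_poly_2:
  assumes A: "(A :: 'a :: field mat) \<in> carrier_mat 2 2"
  shows "char_poly A = [: det A, - (A $$ (0,0) + A $$ (1,1)), 1 :]"
proof -
  have "char_poly_matrix A \<in> carrier_mat 2 2"
    using A by simp
  then show ?thesis
    using A unfolding char_poly_def det_2[OF A]
    by (subst det_2) (auto simp: char_poly_matrix_def algebra_simps)
qed

text \<open>Subtracting \<open>z\<close> on the diagonal leaves the upper right entry untouched, so
  the first row of the shifted matrix is nonzero and its kernel is at most a line. Singularity at an
  eigenvalue makes it exactly a line.\<close>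

lemma geom_mult_2:
  assumes A: "A \<in> carrier_mat 2 2" and nz: "A $$ (0,1) \<noteq> 0" and ev: "eigenvalue A z"
  shows "geom_mult A z = 1"
proof -
  define B where "B = char_matrix A z"
  have B: "B \<in> carrier_mat 2 2"
    using A unfolding B_def by simp
  have b: "B $$ (0,1) \<noteq> 0"
    using A nz unfolding B_def char_matrix_def by simp
  have det: "B $$ (0,0) * B $$ (1,1) = B $$ (0,1) * B $$ (1,0)"
    using ev unfolding eigenvalue_det[OF A] B_def[symmetric] det_2[OF B] by simp
  \<comment> \<open>The vector \<open>v\<close> is the first row of \<open>B\<close> turned by a
    right angle, so that row kills it at once; the vanishing determinant takes care of the second
    row.\<close>
  define v where "v = vec 2 (\<lambda>i. if i = 0 then B $$ (0,1) else - B $$ (0,0))"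
  have Bx: "B *\<^sub>v x = 0\<^sub>v 2 \<longleftrightarrow>
      B $$ (0,0) * x $ 0 + B $$ (0,1) * x $ 1 = 0 \<and> B $$ (1,0) * x $ 0 + B $$ (1,1) * x $ 1 = 0"
    if "x \<in> carrier_vec 2" for x
    using that B by (auto simp: vec_eq_iff scalar_prod_def numeral_2_eq_2 less_Suc_eq)
  have v: "v \<in> mat_kernel B"
    using det by (intro mat_kernelI[OF B]) (auto simp: Bx v_def algebra_simps)
  have v0: "v \<noteq> 0\<^sub>v 2"
    using b by (auto simp: v_def vec_eq_iff)
  have multiple: "x = (x $ 0 / B $$ (0,1)) \<cdot>\<^sub>v v" if "x \<in> mat_kernel B" for x
  proof -
    have x: "x \<in> carrier_vec 2" and "B *\<^sub>v x = 0\<^sub>v 2"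
      using mat_kernelD[OF B that] by auto
    \<comment> \<open>The first row alone already determines the second coordinate of a kernel
      vector from the first.\<close>
    then have "B $$ (0,1) * x $ 1 = - B $$ (0,0) * x $ 0"
      using Bx[OF x] by (simp add: add_eq_0_iff2)
    then have "x $ 1 = - B $$ (0,0) * x $ 0 / B $$ (0,1)"
      using b by (simp add: field_simps)
    then show ?thesis
      using x b by (auto simp: v_def vec_eq_iff less_Suc_eq numeral_2_eq_2)
  qed
  interpret K: kernel 2 2 B
    by unfold_locales (rule B)
  have "K.span {v} = mat_kernel B"
  proof
    show "K.span {v} \<subseteq> mat_kernel B"
      using K.Ker.span_is_subset2[of "{v}"] v by simp
    show "mat_kernel B \<subseteq> K.span {v}"
    proof
      fix x assume "x \<in> mat_kernel B"
      then have "x = (x $ 0 / B $$ (0,1)) \<cdot>\<^sub>v v" by (rule multiple)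
      moreover have "v \<in> K.span {v}"
        using K.Ker.in_own_span[of "{v}"] v by simp
      ultimately show "x \<in> K.span {v}"
        using K.span_same[of "{v}"] K.NC.smult_in_span[of "{v}" v] mat_kernelD(1)[OF B v] v
        by (metis empty_subsetI insert_subset)
    qed
  qed
  then have "K.dim = 1"
    using K.Ker.dim1I[of v] v v0 by simp
  then show ?thesis
    unfolding geom_mult_def B_def[symmetric] by simp
qed

section \<open>Bounds on the spectral radius through eigenvalues\<close>

lemma spectral_radius_less_iff:
  assumes "A \<in> carrier_mat n n" and "n > 0"
  shows "spectral_radius A < r \<longleftrightarrow> (\<forall>z. eigenvalue A z \<longrightarrow> cmod z < r)"
proof
  assume "spectral_radius A < r"
  then show "\<forall>z. eigenvalue A z \<longrightarrow> cmod z < r"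
    using spectral_radius_mem_max(2)[OF assms] by (fastforce simp: spectrum_def)
next
  assume "\<forall>z. eigenvalue A z \<longrightarrow> cmod z < r"
  then show "spectral_radius A < r"
    using spectral_radius_mem_max(1)[OF assms] by (auto simp: spectrum_def)
qed

lemma spectral_radius_ge:
  assumes "A \<in> carrier_mat n n" and "n > 0" and "eigenvalue A z"
  shows "cmod z \<le> spectral_radius A"
  using spectral_radius_mem_max(2)[OF assms(1,2)] assms(3) by (simp add: spectrum_def)

lemma spectral_radius_eqI:
  assumes A: "A \<in> carrier_mat n n" and n: "n > 0"
    and "\<And>z. eigenvalue A z \<Longrightarrow> cmod z \<le> r" and "eigenvalue A w" and "cmod w = r"
  shows "spectral_radius A = r"
  using spectral_radius_mem_max(1)[OF A n] spectral_radius_ge[OF A n] assms(3-5)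
  by (force simp: spectrum_def)

section \<open>Roots of monic quadratics: multiplicity and location\<close>

lemma monic_quadratic_factor:
  fixes z t c :: "'a :: idom"
  assumes "poly [:c, - t, 1:] z = 0"
  shows "[:c, - t, 1:] = [:- z, 1:] * [:- (t - z), 1:]"
  using assms by (simp add: algebra_simps add_eq_0_iff2)

text \<open>By Vieta the second root is \<open>t - z\<close>, and orders add over the two linear
  factors; the second factor contributes exactly when \<open>t - z = z\<close>.\<close>

lemma order_monic_quadratic:
  fixes z t c :: "'a :: idom"
  assumes "poly [:c, - t, 1:] z = 0"
  shows "Polynomial.order z [:c, - t, 1:] = (if t = 2 * z then 2 else 1)"
proof -
  have "Polynomial.order z [:c, - t, 1:]
      = Polynomial.order z [:- z, 1:] + Polynomial.order z [:- (t - z), 1:]"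
    unfolding monic_quadratic_factor[OF assms] by (rule order_mult) simp
  moreover have "Polynomial.order z [:- z, 1:] = 1"
    using order_power_n_n[of z 1] by simp
  moreover have "Polynomial.order z [:- (t - z), 1:] = (if t = 2 * z then 1 else 0)"
  proof (cases "t = 2 * z")
    case True
    then have "[:- (t - z), 1:] = [:- z, 1:] ^ 1" by simp
    then show ?thesis using True order_power_n_n[of z 1] by simp
  next
    case False
    then have "poly [:- (t - z), 1:] z \<noteq> 0" by (simp add: algebra_simps)
    then show ?thesis using False order_0I by metis
  qed
  ultimately show ?thesis by simp
qed

text \<open>A root off the real axis comes with its conjugate, so \<^term>\<open>c\<close> is its squared modulus.\<close>

lemma real_monic_quadratic_root_cases:
  fixes t c :: real and z :: complex
  assumes "z^2 - t * z + c = 0"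
  obtains x :: real where "z = x" "x^2 - t * x + c = 0"
    | "Im z \<noteq> 0" "cmod z ^ 2 = c" "t = 2 * Re z"
proof (cases "Im z = 0")
  case True
  then have z: "z = Re z" by (simp add: complex_eq_iff)
  have "complex_of_real ((Re z)^2 - t * Re z + c) = 0"
    using assms by (subst (asm) (1 2) z) simp
  then show ?thesis using that(1)[OF z] of_real_eq_0_iff by blast
next
  case False
  have re: "(Re z)^2 - (Im z)^2 - t * Re z + c = 0" and im: "2 * Re z * Im z - t * Im z = 0"
    using assms by (auto simp: complex_eq_iff power2_eq_square)
  from im False have t: "t = 2 * Re z" by (simp add: algebra_simps)
  have "cmod z ^ 2 = c" using re unfolding t cmod_power2 by (simp add: power2_eq_square)
  then show ?thesis using that(2) False t by blast
qed

text \<open>Sufficiency in the Jury criterion: the bound on \<open>t\<close> says that the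
  polynomial is positive at both \<open>1\<close> and \<open>-1\<close>. Nonreal roots have squared
  modulus \<open>c\<close>; real ones are excluded on each side by a sign comparison.\<close>

lemma real_monic_quadratic_roots_in_disc:
  fixes t c :: real and z :: complex
  assumes root: "z^2 - t * z + c = 0" and "c < 1" and "\<bar>t\<bar> < 1 + c"
  shows "cmod z < 1"
  using root
proof (cases rule: real_monic_quadratic_root_cases)
  case (1 x)
  have "x < 1"
  proof (rule ccontr)
    assume "\<not> x < 1"
    \<comment> \<open>Both factors are nonnegative since \<open>x \<ge> 1 > c\<close>, whereas
      substituting the root equation turns the product into a negative number.\<close>
    then have "0 \<le> (x - 1) * (x - c)" using assms by (intro mult_nonneg_nonneg) auto
    also have "\<dots> = x * (t - (1 + c))" using 1(2) by (simp add: algebra_simps power2_eq_square)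
    also have "\<dots> < 0" using assms \<open>\<not> x < 1\<close> by (intro mult_pos_neg) auto
    finally show False by simp
  qed
  moreover have "x > -1"
  proof (rule ccontr)
    assume "\<not> x > -1"
    \<comment> \<open>The same argument after the reflection of \<open>x\<close> and
      \<open>t\<close> to \<open>- x\<close> and \<open>- t\<close>.\<close>
    then have "0 \<le> (- x - 1) * (- x - c)" using assms by (intro mult_nonneg_nonneg) auto
    also have "\<dots> = (- x) * (- t - (1 + c))" using 1(2) by (simp add: algebra_simps power2_eq_square)
    also have "\<dots> < 0" using assms \<open>\<not> x > -1\<close> by (intro mult_pos_neg) auto
    finally show False by simp
  qed
  ultimately show ?thesis using 1(1) by simp
next
  case 2
  then show ?thesis using assms(2) by (metis norm_ge_zero power2_less_imp_less one_power2 zero_le_one)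
qed

text \<open>A negative value at \<open>-1\<close> of a parabola opening upwards places
  \<open>-1\<close> strictly between two real roots; the smaller one is the witness.\<close>

lemma real_monic_quadratic_root_less:
  fixes t c :: real
  assumes "1 + t + c < 0"
  obtains x :: real where "x^2 - t * x + c = 0" and "x < - 1"
proof -
  define s where "s = sqrt (t^2 - 4 * c)"
  \<comment> \<open>The difference of the two sides is \<open>- 4 * (1 + t + c)\<close>. The
    estimate yields both a positive discriminant and the location of the smaller root.\<close>
  have gt: "t^2 - 4 * c > (t + 2)^2"
    using assms by (simp add: power2_eq_square algebra_simps)
  then have "s^2 = t^2 - 4 * c"
    unfolding s_def by (meson less_imp_le order_le_less_trans real_sqrt_pow2 zero_le_power2)
  then have "((t - s) / 2)^2 - t * ((t - s) / 2) + c = 0"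
    by (simp add: power2_eq_square field_simps)
  moreover have "s > \<bar>t + 2\<bar>"
    unfolding s_def using gt by (metis real_sqrt_abs real_sqrt_less_iff)
  then have "(t - s) / 2 < - 1" by simp
  ultimately show ?thesis using that by blast
qed

section \<open>Determinant, trace and spectrum of \<open>T_mat\<close>\<close>

context
  fixes h \<gamma> \<beta> q :: real
begin

definition T_det :: real where
  "T_det = (1 - h * q * \<beta>) / (1 + h * \<gamma>)"

definition T_trace :: real where
  "T_trace = 1 - h^2 * q / (1 + h * \<gamma>) + T_det"

lemma T_mat_carrier: "T_mat h \<gamma> \<beta> q \<in> carrier_mat 2 2"
  by (rule carrier_matI) (simp_all add: T_mat_def mat_of_rows_list_def)

lemma cmat_T_mat_carrier: "cmat (T_mat h \<gamma> \<beta> q) \<in> carrier_mat 2 2"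
  using T_mat_carrier by simp

lemma T_mat_index:
  "T_mat h \<gamma> \<beta> q $$ (0, 0) = 1 - h^2 * q / (1 + h * \<gamma>)"
  "T_mat h \<gamma> \<beta> q $$ (0, 1) = h * T_det"
  "T_mat h \<gamma> \<beta> q $$ (1, 0) = - (h * q / (1 + h * \<gamma>))"
  "T_mat h \<gamma> \<beta> q $$ (1, 1) = T_det"
  by (simp_all add: T_mat_def mat_of_rows_list_def T_det_def)

text \<open>The two terms with \<open>h^2 * q\<close> cancel, which leaves the lower right
  entry.\<close>

lemma det_T_mat: "det (T_mat h \<gamma> \<beta> q) = T_det"
  unfolding det_2[OF T_mat_carrier] T_mat_index
  by (simp add: algebra_simps power2_eq_square)

lemma char_poly_cmat_T_mat:
  "char_poly (cmat (T_mat h \<gamma> \<beta> q)) = [:of_real T_det, - of_real T_trace, 1:]"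
  using T_mat_carrier T_mat_index
  by (simp add: char_poly_2[OF cmat_T_mat_carrier] of_real_hom.hom_det det_T_mat T_trace_def)

lemma eigenvalue_T_mat:
  "eigenvalue (cmat (T_mat h \<gamma> \<beta> q)) z \<longleftrightarrow> z^2 - of_real T_trace * z + of_real T_det = 0"
  unfolding eigenvalue_root_char_poly[OF cmat_T_mat_carrier] char_poly_cmat_T_mat
  by (simp add: algebra_simps power2_eq_square)

lemma eigenvalue_T_mat_of_real:
  "eigenvalue (cmat (T_mat h \<gamma> \<beta> q)) (complex_of_real x) \<longleftrightarrow> x^2 - T_trace * x + T_det = 0"
proof -
  have "(complex_of_real x)^2 - of_real T_trace * of_real x + of_real T_det = of_real (x^2 - T_trace * x + T_det)"
    by simp
  then show ?thesis unfolding eigenvalue_T_mat by (metis of_real_eq_0_iff)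
qed

lemma alg_mult_T_mat:
  assumes "eigenvalue (cmat (T_mat h \<gamma> \<beta> q)) z"
  shows "alg_mult (cmat (T_mat h \<gamma> \<beta> q)) z = (if complex_of_real T_trace = 2 * z then 2 else 1)"
  using assms unfolding alg_mult_def eigenvalue_root_char_poly[OF cmat_T_mat_carrier] char_poly_cmat_T_mat
  by (rule order_monic_quadratic)

lemma geom_mult_T_mat:
  assumes "h * T_det \<noteq> 0" and "eigenvalue (cmat (T_mat h \<gamma> \<beta> q)) z"
  shows "geom_mult (cmat (T_mat h \<gamma> \<beta> q)) z = 1"
  using assms T_mat_carrier T_mat_index(2)
  by (intro geom_mult_2[OF cmat_T_mat_carrier]) simp_all

text \<open>The hypothesis is Vieta's product formula for a known real root \<open>a\<close>; it is
  used with \<open>a = 1\<close> and \<open>a = - 1\<close> to read off the other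
  eigenvalue.\<close>

lemma spectrum_T_mat:
  assumes "T_det = a * (T_trace - a)"
  shows "spectrum (cmat (T_mat h \<gamma> \<beta> q)) = {complex_of_real a, complex_of_real (T_trace - a)}"
proof -
  have "z^2 - of_real T_trace * z + of_real T_det = (z - of_real a) * (z - of_real (T_trace - a))"
    for z :: complex
    unfolding assms by (simp add: algebra_simps power2_eq_square)
  then show ?thesis unfolding spectrum_def eigenvalue_T_mat by auto
qed

lemma schur_stable_T_mat:
  "schur_stable (T_mat h \<gamma> \<beta> q) \<longleftrightarrow> (\<forall>z. eigenvalue (cmat (T_mat h \<gamma> \<beta> q)) z \<longrightarrow> cmod z < 1)"
  using spectral_radius_less_iff[OF cmat_T_mat_carrier] T_mat_carrier
  by (auto simp: schur_stable_def)

end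

theorem theorem5p5:
  fixes q h \<gamma> \<beta> :: real
  assumes "q \<ge> 0" and "h > 0" and "\<gamma> \<ge> 0" and "\<beta> \<ge> 0"
  shows
    "(q > 0 \<and> \<gamma> + q * \<beta> > 0 \<longrightarrow>
        (schur_stable (T_mat h \<gamma> \<beta> q) \<longleftrightarrow> q * h * (h + 2 * \<beta>) < 4 + 2 * h * \<gamma>) \<and>
        (q * h * (h + 2 * \<beta>) = 4 + 2 * h * \<gamma> \<longrightarrow>
           eigenvalue (cmat (T_mat h \<gamma> \<beta> q)) (- 1) \<and>
           (\<exists>\<mu>. spectrum (cmat (T_mat h \<gamma> \<beta> q)) = {- 1, \<mu>} \<and> cmod \<mu> < 1)) \<and>
        (q * h * (h + 2 * \<beta>) > 4 + 2 * h * \<gamma> \<longrightarrow>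
           (\<exists>x :: real. eigenvalue (cmat (T_mat h \<gamma> \<beta> q)) (complex_of_real x) \<and> x < - 1)))
     \<and>
     (q = 0 \<longrightarrow>
        spectrum (cmat (T_mat h \<gamma> \<beta> q)) = {1, complex_of_real (inverse (1 + h * \<gamma>))} \<and>
        \<not> schur_stable (T_mat h \<gamma> \<beta> q) \<and>
        (\<gamma> > 0 \<longrightarrow>
           semistable (T_mat h \<gamma> \<beta> q) \<and>
           (\<forall>z. eigenvalue (cmat (T_mat h \<gamma> \<beta> q)) z \<and> cmod z = 1 \<longrightarrow> z = 1)) \<and>
        (\<gamma> = 0 \<longrightarrow>
           similar_mat (T_mat h \<gamma> \<beta> q) (jordan_block 2 1) \<and>
           defective_double_eigenvalue (T_mat h \<gamma> \<beta> q) 1))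
     \<and>
     (q > 0 \<and> \<gamma> = 0 \<and> \<beta> = 0 \<longrightarrow>
        \<not> schur_stable (T_mat h \<gamma> \<beta> q) \<and>
        (h < 2 / sqrt q \<longrightarrow>
           marginally_stable (T_mat h \<gamma> \<beta> q) \<and>
           (\<forall>z. eigenvalue (cmat (T_mat h \<gamma> \<beta> q)) z \<longrightarrow> cmod z = 1)) \<and>
        (h = 2 / sqrt q \<longrightarrow> defective_double_eigenvalue (T_mat h \<gamma> \<beta> q) (- 1)) \<and>
        (h > 2 / sqrt q \<longrightarrow> spectral_radius (cmat (T_mat h \<gamma> \<beta> q)) > 1))"
proof -

  \<comment> \<open>Values of the characteristic polynomial at \<open>1\<close> and
    \<open>-1\<close>\<close>
  let ?A = "cmat (T_mat h \<gamma> \<beta> q)"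
  define D where "D = T_det h \<gamma> \<beta> q"
  define t where "t = T_trace h \<gamma> \<beta> q"
  note ev = eigenvalue_T_mat[of h \<gamma> \<beta> q, folded D_def t_def]
    and ev_real = eigenvalue_T_mat_of_real[of h \<gamma> \<beta> q, folded D_def t_def]
    and spec = spectrum_T_mat[of h \<gamma> \<beta> q, folded D_def t_def]
    and alg = alg_mult_T_mat[of h \<gamma> \<beta> q, folded D_def t_def]
    and geom = geom_mult_T_mat[of h \<gamma> \<beta> q, folded D_def t_def]
    and A = cmat_T_mat_carrier[of h \<gamma> \<beta> q]
  have d: "1 + h * \<gamma> > 0"
    using assms by (simp add: add_pos_nonneg)
  have at_1: "1 - t + D = h^2 * q / (1 + h * \<gamma>)"
    by (simp add: t_def D_def T_trace_def)
  have at_m1: "1 + t + D = (4 + 2 * h * \<gamma> - q * h * (h + 2 * \<beta>)) / (1 + h * \<gamma>)"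
  proof -
    \<comment> \<open>Denominators are cleared by \<open>e\<close>. Since \<open>t\<close> itself
      contains \<open>D\<close>, the sum is split as \<open>1 + (t - D) + 2 * D\<close>.\<close>
    define e where "e = 1 + h * \<gamma>"
    have "D * e = 1 - h * q * \<beta>"
      using d by (simp add: D_def T_det_def e_def)
    moreover have "(t - D) * e = e - h^2 * q"
      using d by (simp add: t_def D_def T_trace_def e_def[symmetric] left_diff_distrib)
    ultimately have "(1 + t + D) * e = 2 * e + 2 * (1 - h * q * \<beta>) - h^2 * q"
      by (simp add: algebra_simps)
    also have "\<dots> = 4 + 2 * h * \<gamma> - q * h * (h + 2 * \<beta>)"
      by (simp add: e_def algebra_simps power2_eq_square)
    finally show ?thesis
      using d by (simp add: eq_divide_eq e_def)
  qed
  have real_ev: "\<exists>x :: real. eigenvalue ?A (complex_of_real x) \<and> x < - 1" if "1 + t + D < 0"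
    using real_monic_quadratic_root_less[OF that] ev_real by metis
  have square: "square_mat (T_mat h \<gamma> \<beta> q)"
    using T_mat_carrier[of h \<gamma> \<beta> q] by auto

  \<comment> \<open>Case of positive stiffness \<open>q\<close> with damping\<close>
  have damped: "(schur_stable (T_mat h \<gamma> \<beta> q) \<longleftrightarrow> q * h * (h + 2 * \<beta>) < 4 + 2 * h * \<gamma>) \<and>
        (q * h * (h + 2 * \<beta>) = 4 + 2 * h * \<gamma> \<longrightarrow>
           eigenvalue ?A (- 1) \<and> (\<exists>\<mu>. spectrum ?A = {- 1, \<mu>} \<and> cmod \<mu> < 1)) \<and>
        (q * h * (h + 2 * \<beta>) > 4 + 2 * h * \<gamma> \<longrightarrow>
           (\<exists>x :: real. eigenvalue ?A (complex_of_real x) \<and> x < - 1))"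
    if "q > 0" and damping: "\<gamma> + q * \<beta> > 0"
  proof -
    \<comment> \<open>This is the gap between denominator and numerator of \<open>D\<close>, so
      damping is precisely what pushes the determinant below \<open>1\<close>.\<close>
    have "h * (\<gamma> + q * \<beta>) > 0" using assms(2) damping by simp
    then have D1: "D < 1"
      using d by (simp add: D_def T_det_def algebra_simps)
    have pos_1: "1 - t + D > 0"
      unfolding at_1 using that assms(2) d by simp
    have less: "q * h * (h + 2 * \<beta>) < 4 + 2 * h * \<gamma> \<longleftrightarrow> 1 + t + D > 0"
      and eq: "q * h * (h + 2 * \<beta>) = 4 + 2 * h * \<gamma> \<longleftrightarrow> 1 + t + D = 0"
      and greater: "q * h * (h + 2 * \<beta>) > 4 + 2 * h * \<gamma> \<longleftrightarrow> 1 + t + D < 0"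
      unfolding at_m1 using d by (auto simp: zero_less_divide_iff divide_less_0_iff)
    have minus_1: "eigenvalue ?A (- 1)" if "1 + t + D = 0"
      using ev_real[of "- 1"] that by (simp add: algebra_simps)
    have "\<exists>\<mu>. spectrum ?A = {- 1, \<mu>} \<and> cmod \<mu> < 1" if zero: "1 + t + D = 0"
    proof -
      have "spectrum ?A = {- 1, complex_of_real (- D)}"
      proof -
        have t: "t = - 1 - D" using zero by simp
        show ?thesis using spec[of "- 1"] unfolding t by simp
      qed
      \<comment> \<open>With \<open>t = - 1 - D\<close>, positivity at \<open>1\<close> becomes
        \<open>2 + 2 * D > 0\<close>, the lower bound on \<open>D\<close>.\<close>
      moreover have "\<bar>D\<bar> < 1" using D1 pos_1 zero by simp
      ultimately show ?thesis by (metis abs_minus_cancel norm_of_real)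
    qed
    moreover have "schur_stable (T_mat h \<gamma> \<beta> q) \<longleftrightarrow> 1 + t + D > 0"
    proof
      assume pos: "1 + t + D > 0"
      then have "\<bar>t\<bar> < 1 + D" using pos_1 by simp
      then show "schur_stable (T_mat h \<gamma> \<beta> q)"
        using real_monic_quadratic_roots_in_disc D1 by (simp add: schur_stable_T_mat ev)
    next
      assume schur: "schur_stable (T_mat h \<gamma> \<beta> q)"
      \<comment> \<open>A zero value at \<open>-1\<close> gives the eigenvalue \<open>-1\<close>,
        and a negative one gives a real eigenvalue below \<open>-1\<close>; stability forbids
        both.\<close>
      have "1 + t + D \<noteq> 0"
        using minus_1 schur unfolding schur_stable_T_mat by fastforce
      moreover have "\<not> 1 + t + D < 0"
        using real_ev schur unfolding schur_stable_T_mat by fastforce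
      ultimately show "1 + t + D > 0" by simp
    qed
    ultimately show ?thesis
      unfolding less eq greater using minus_1 real_ev by blast
  qed

  \<comment> \<open>Case \<open>q = 0\<close>: eigenvalues \<open>1\<close> and
    \<open>D\<close>\<close>
  have free: "spectrum ?A = {1, complex_of_real (inverse (1 + h * \<gamma>))} \<and>
        \<not> schur_stable (T_mat h \<gamma> \<beta> q) \<and>
        (\<gamma> > 0 \<longrightarrow> semistable (T_mat h \<gamma> \<beta> q) \<and>
           (\<forall>z. eigenvalue ?A z \<and> cmod z = 1 \<longrightarrow> z = 1)) \<and>
        (\<gamma> = 0 \<longrightarrow> similar_mat (T_mat h \<gamma> \<beta> q) (jordan_block 2 1) \<and>
           defective_double_eigenvalue (T_mat h \<gamma> \<beta> q) 1)" if q: "q = 0"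
  proof -
    have D: "D = inverse (1 + h * \<gamma>)" and t: "t = 1 + D"
      using q by (simp_all add: D_def t_def T_det_def T_trace_def inverse_eq_divide)
    have nz: "h * D \<noteq> 0" using d assms(2) unfolding D by simp
    have spectrum: "spectrum ?A = {1, complex_of_real D}"
      using spec[of 1] t by simp
    then have evs: "eigenvalue ?A z \<longleftrightarrow> z = 1 \<or> z = complex_of_real D" for z
      unfolding spectrum_def by auto
    have "\<not> schur_stable (T_mat h \<gamma> \<beta> q)"
      unfolding schur_stable_T_mat using evs by fastforce
    moreover have "semistable (T_mat h \<gamma> \<beta> q) \<and> (\<forall>z. eigenvalue ?A z \<and> cmod z = 1 \<longrightarrow> z = 1)"
      if "\<gamma> > 0"
    proof -
      have D01: "0 < D" "D < 1"
        using that assms(2) d unfolding D by (simp_all add: inverse_less_1_iff)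
      have only_1: "z = 1" if "eigenvalue ?A z" "cmod z = 1" for z
        using that D01 evs by auto
      have "spectral_radius ?A = 1"
        using D01 by (intro spectral_radius_eqI[OF A, where w = 1]) (auto simp: evs)
      \<comment> \<open>The trace \<open>1 + D\<close> is less than \<open>2\<close>, so
        \<open>1\<close> is a simple root and hence semisimple.\<close>
      moreover have "complex_of_real t \<noteq> 2 * 1"
        using D01 t by (auto simp: complex_eq_iff)
      ultimately have "semistable (T_mat h \<gamma> \<beta> q)"
        using only_1 D01 alg[of 1] geom[OF nz, of 1] evs square
        unfolding semistable_def semisimple_eigenvalue_def by auto
      then show ?thesis using only_1 by blast
    qed
    moreover have "similar_mat (T_mat h \<gamma> \<beta> q) (jordan_block 2 1) \<and>
        defective_double_eigenvalue (T_mat h \<gamma> \<beta> q) 1" if "\<gamma> = 0"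
    proof
      \<comment> \<open>Here the matrix is unipotent with off-diagonal entry \<open>h\<close>;
        conjugation by the diagonal matrix with entries \<open>h\<close> and \<open>1\<close>
        rescales that entry to \<open>1\<close>.\<close>
      let ?P = "mat_of_rows_list 2 [[h, 0], [0, 1 :: real]]"
      let ?Q = "mat_of_rows_list 2 [[1 / h, 0], [0, 1 :: real]]"
      have "similar_mat_wit (T_mat h \<gamma> \<beta> q) (jordan_block 2 1) ?P ?Q"
        using assms(2) q that
        by (intro similar_mat_witI[of _ _ 2])
          (auto simp: T_mat_def mat_of_rows_list_def jordan_block_def scalar_prod_def
            numeral_2_eq_2 less_Suc_eq intro!: eq_matI)
      then show "similar_mat (T_mat h \<gamma> \<beta> q) (jordan_block 2 1)"
        unfolding similar_mat_def by blast
      have "D = 1" using D that by simp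
      then show "defective_double_eigenvalue (T_mat h \<gamma> \<beta> q) 1"
        using alg[of 1] geom[OF nz, of 1] evs t unfolding defective_double_eigenvalue_def by auto
    qed
    ultimately show ?thesis using spectrum D by auto
  qed

  \<comment> \<open>Case of positive \<open>q\<close> without damping: determinant
    \<open>1\<close>\<close>
  have undamped: "\<not> schur_stable (T_mat h \<gamma> \<beta> q) \<and>
        (h < 2 / sqrt q \<longrightarrow> marginally_stable (T_mat h \<gamma> \<beta> q) \<and>
           (\<forall>z. eigenvalue ?A z \<longrightarrow> cmod z = 1)) \<and>
        (h = 2 / sqrt q \<longrightarrow> defective_double_eigenvalue (T_mat h \<gamma> \<beta> q) (- 1)) \<and>
        (h > 2 / sqrt q \<longrightarrow> spectral_radius ?A > 1)"
    if q: "q > 0" and "\<gamma> = 0" "\<beta> = 0"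
  proof -
    have D: "D = 1" and t: "t = 2 - h^2 * q"
      using that by (simp_all add: D_def t_def T_det_def T_trace_def)
    have nz: "h * D \<noteq> 0" using assms(2) D by simp
    \<comment> \<open>In terms of \<open>h * sqrt q\<close> the threshold is the value
      \<open>2\<close>, which corresponds to \<open>t = - 2\<close>.\<close>
    have h2q: "h^2 * q = (h * sqrt q)^2" using q by (simp add: power_mult_distrib)
    have hq: "h * sqrt q > 0" using assms(2) q by simp
    obtain z0 where z0: "eigenvalue ?A z0"
      using spectrum_non_empty[OF A] by (auto simp: spectrum_def)
    have "\<not> schur_stable (T_mat h \<gamma> \<beta> q)"
    proof
      assume schur: "schur_stable (T_mat h \<gamma> \<beta> q)"
      \<comment> \<open>The two eigenvalues have product \<open>D = 1\<close>, so they cannot both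
        lie strictly inside the unit disk.\<close>
      have prod: "z0 * (of_real t - z0) = 1"
        using z0 D by (simp add: ev algebra_simps power2_eq_square add_eq_0_iff2)
      then have "eigenvalue ?A (of_real t - z0)"
        using D by (simp add: ev algebra_simps power2_eq_square)
      then have "cmod z0 * cmod (of_real t - z0) < 1 * 1"
        using z0 schur unfolding schur_stable_T_mat by (intro mult_strict_mono) auto
      then show False
        using prod by (metis norm_mult norm_one mult_1 less_irrefl)
    qed
    moreover have "marginally_stable (T_mat h \<gamma> \<beta> q) \<and> (\<forall>z. eigenvalue ?A z \<longrightarrow> cmod z = 1)"
      if "h < 2 / sqrt q"
    proof -
      have "h * sqrt q < 2" using that q by (simp add: pos_less_divide_eq)
      then have "(h * sqrt q)^2 < 2^2" using hq by (intro power_strict_mono) auto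
      moreover have "(h * sqrt q)^2 > 0" using hq by (rule zero_less_power)
      ultimately have t2: "\<bar>t\<bar> < 2"
        unfolding t h2q power2_eq_square[of 2] abs_less_iff by simp
      then have t4: "t^2 < 4" using abs_square_less_1[of "t / 2"] by (simp add: power_divide)
      have unimodular: "cmod z = 1" if "eigenvalue ?A z" for z
        using that[unfolded ev]
      proof (cases rule: real_monic_quadratic_root_cases)
        case (1 x)
        \<comment> \<open>Completing the square: a real root would make the negative discriminant a
          square. Only nonreal roots remain, with squared modulus \<open>D = 1\<close>.\<close>
        then have "(2 * x - t)^2 = t^2 - 4"
          by (simp add: D power2_eq_square algebra_simps)
        then show ?thesis using t4 by (smt (verit) zero_le_power2)
      next
        case 2
        then have "cmod z ^ 2 = 1 ^ 2" using D by simp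
        then show ?thesis by (rule power2_eq_imp_eq) simp_all
      qed
      \<comment> \<open>A double root would be \<open>t / 2\<close>, whose modulus is below
        \<open>1\<close>, contrary to unimodularity. Every eigenvalue is thus simple.\<close>
      have "complex_of_real t \<noteq> 2 * z" if "eigenvalue ?A z" for z
      proof
        assume "complex_of_real t = 2 * z"
        then have "\<bar>t\<bar> = 2 * cmod z" by (metis norm_mult norm_numeral norm_of_real)
        then show False using unimodular[OF that] t2 by simp
      qed
      moreover have "spectral_radius ?A = 1"
        using unimodular z0 by (intro spectral_radius_eqI[OF A, where w = z0]) auto
      ultimately have "marginally_stable (T_mat h \<gamma> \<beta> q)"
        using alg geom[OF nz] square unfolding semistable_def semisimple_eigenvalue_def by auto
      then show ?thesis using unimodular by blast
    qed
    moreover have "defective_double_eigenvalue (T_mat h \<gamma> \<beta> q) (- 1)" if "h = 2 / sqrt q"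
    proof -
      have "h * sqrt q = 2" using that q by simp
      \<comment> \<open>The trace is twice the root \<open>-1\<close>, so the root is double, while
        its eigenspace is a line.\<close>
      then have "t = - 2" unfolding t h2q by simp
      moreover from this have "eigenvalue ?A (- 1)" by (simp add: ev D)
      ultimately show ?thesis
        using alg[of "- 1"] geom[OF nz, of "- 1"] unfolding defective_double_eigenvalue_def by simp
    qed
    moreover have "spectral_radius ?A > 1" if "h > 2 / sqrt q"
    proof -
      have "h * sqrt q > 2" using that q by (simp add: pos_divide_less_eq)
      then have "(h * sqrt q)^2 > 2^2" by (intro power_strict_mono) auto
      \<comment> \<open>The value at \<open>-1\<close> is \<open>4 - (h * sqrt q)^2\<close>,
        negative beyond the threshold.\<close>
      then have "1 + t + D < 0" unfolding t h2q D by simp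
      then obtain x :: real where "eigenvalue ?A (complex_of_real x)" "x < - 1"
        using real_ev by blast
      then show ?thesis using spectral_radius_ge[OF A, of "complex_of_real x"] by simp
    qed
    ultimately show ?thesis by blast
  qed
  show ?thesis using damped free undamped by blast
qed

end
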